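(* Let $k$ be a positive integer and let $$b_k'=(-1)^{k(k+1)/2}\left(\frac{d}{dx}\right)^{2k}\left(e^{-x/2}x^{-k^2/2}\det_{k\times k}\big(I_{i+j-1}(2\sqrt{x})\big)_{1\le i,j\le k}\right)\bigg|_{x=0}.$$ Then $$b_k'=(-1)^{k(k+1)/2}\sum_{m\in P_O^{k+1}(2k)}\binom{2k}{m}\left(\frac{-1}{2}\right)^{m_0}\left(\prod_{i=1}^k\frac{1}{(2k-i+m_i)!}\right)\left(\prod_{1\le i<j\le k}(m_j-m_i+i-j)\right).$$
   Context: $P_O^{k+1}(2k)$ is the set of $(k+1)$-tuples $m=(m_0,m_1,\dots,m_k)$ of non-negative integers with $m_0+\dots+m_k=2k$, and $\binom{2k}{m}=\frac{(2k)!}{m_0!\cdots m_k!}$ is the multinomial coefficient. $I_\nu$ is the modified Bessel function of the first kind, $I_n(x)=(x/2)^n\sum_{j\ge0}\frac{x^{2j}}{2^{2j}(n+j)!\,j!}$; the expression $x^{-k^2/2}\det(I_{i+j-1}(2\sqrt x))$ is a power series in $x$. *)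

theory Defs
  imports "HOL-Complex_Analysis.Complex_Analysis" "Jordan_Normal_Form.Determinant"
begin

definition bessel_I :: "nat \<Rightarrow> complex \<Rightarrow> complex" where
  "bessel_I n x = (x / 2) ^ n * (\<Sum>j. x ^ (2 * j) / (2 ^ (2 * j) * fact (n + j) * fact j))"

text \<open>Matrix indices start at 0, so the entry with 1-based indices \<open>i + 1, j + 1\<close> has
  Bessel order \<open>i + j + 1\<close>.\<close>

definition bessel_det :: "nat \<Rightarrow> complex \<Rightarrow> complex" where
  "bessel_det k x =
     Determinant.det (Matrix.mat k k (\<lambda>(i, j). bessel_I (i + j + 1) (2 * csqrt x)))"

definition bessel_expr :: "nat \<Rightarrow> complex \<Rightarrow> complex" where
  "bessel_expr k x = exp (- x / 2) * x powr (- (of_nat k ^ 2 / 2)) * bessel_det k x"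

text \<open>With principal branches of \<open>x powr (- k\<^sup>2 / 2)\<close> and \<open>csqrt x\<close> the expression is, for every
  \<open>x \<noteq> 0\<close>, the value of an entire power series (\<open>bessel_expr_eq_series\<close> and
  \<open>remove_sings_bessel_expr\<close> below).  Only the value at 0 has to be filled in by continuity, which
  is what \<open>remove_sings\<close> does.\<close>

definition b' :: "nat \<Rightarrow> complex" where
  "b' k = (-1) ^ (k * (k + 1) div 2) * (deriv ^^ (2 * k)) (remove_sings (bessel_expr k)) 0"

text \<open>A tuple \<open>(m\<^sub>0, m\<^sub>1, \<dots>)\<close> is a list \<open>m\<close> with \<open>m\<^sub>i = m ! i\<close>.\<close>

definition P_O :: "nat \<Rightarrow> nat \<Rightarrow> nat list set" where
  "P_O l n = {m. length m = l \<and> sum_list m = n}"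

definition multinomial :: "nat \<Rightarrow> nat list \<Rightarrow> complex" where
  "multinomial n m = fact n / (\<Prod>i<length m. fact (m ! i))"

definition bessel_series :: "nat \<Rightarrow> complex \<Rightarrow> complex" where
  "bessel_series n x = (\<Sum>l. x ^ l / (fact (n + l) * fact l))"

lemma bessel_series_holomorphic: "bessel_series n holomorphic_on UNIV"
proof -
  define c :: "nat \<Rightarrow> complex" where "c = (\<lambda>l. 1 / (fact (n + l) * fact l))"
  have sm: "summable (\<lambda>l. c l * x ^ l)" for x
  proof (rule summable_comparison_test')
    show "summable (\<lambda>l. norm x ^ l / fact l)"
      using summable_exp[of "norm x"] by (simp add: field_simps)
    fix l :: nat
    have "1 \<le> (fact (n + l) :: real)" by (rule fact_ge_1)
    then have "norm x ^ l / (fact (n + l) * fact l) \<le> norm x ^ l / (1 * fact l)"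
      by (intro divide_left_mono mult_right_mono) auto
    then show "norm (c l * x ^ l) \<le> norm x ^ l / fact l"
      by (simp add: c_def norm_mult norm_divide norm_power)
  qed
  have "((\<lambda>y. \<Sum>l. c l * y ^ l) has_field_derivative (\<Sum>l. diffs c l * x ^ l)) (at x)" for x
    by (rule termdiffs_strong_converges_everywhere) (rule sm)
  then have "(\<lambda>y. \<Sum>l. c l * y ^ l) holomorphic_on UNIV"
    by (auto simp: holomorphic_on_def field_differentiable_def)
  moreover have "bessel_series n = (\<lambda>y. \<Sum>l. c l * y ^ l)"
    by (auto simp: bessel_series_def c_def fun_eq_iff)
  ultimately show ?thesis by simp
qed

lemma bessel_I_2_csqrt: "bessel_I n (2 * csqrt x) = csqrt x ^ n * bessel_series n x"
proof -
  have "(2 * csqrt x) ^ (2 * j) / (2 ^ (2 * j) * fact (n + j) * fact j)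
      = x ^ j / (fact (n + j) * fact j)" for j
  proof -
    have "(2 * csqrt x) ^ (2 * j) = 2 ^ (2 * j) * x ^ j"
      by (simp add: power_mult_distrib power_mult)
    then show ?thesis by simp
  qed
  then show ?thesis by (simp add: bessel_I_def bessel_series_def)
qed

lemma bessel_expr_eq_series:
  assumes "x \<noteq> 0"
  shows "bessel_expr k x =
    exp (- x / 2) * Determinant.det (Matrix.mat k k (\<lambda>(i, j). bessel_series (i + j + 1) x))"
proof -
  let ?s = "csqrt x"
  let ?A = "Matrix.mat k k (\<lambda>(i, j). bessel_I (i + j + 1) (2 * csqrt x))"
  let ?B = "Matrix.mat k k (\<lambda>(i, j). bessel_series (i + j + 1) x)"
  have prod: "(\<Prod>i = 0..<k. ?A $$ (i, p i)) = ?s ^ (k ^ 2) * (\<Prod>i = 0..<k. ?B $$ (i, p i))"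
    if p: "p permutes {0..<k}" for p
  proof -
    have lt: "p i < k" if "i < k" for i
      using permutes_in_image[OF p, of i] that by auto
    have "(\<Sum>i = 0..<k. i + p i + 1) = (\<Sum>i = 0..<k. i) + (\<Sum>i = 0..<k. p i) + k"
      unfolding sum.distrib by simp
    also have "(\<Sum>i = 0..<k. p i) = (\<Sum>i = 0..<k. i)"
      using sum.permute[OF p, of "\<lambda>i. i"] by (simp add: o_def)
    also have "(\<Sum>i = 0..<k. i) + (\<Sum>i = 0..<k. i) + k = k ^ 2"
      by (induction k) (auto simp: power2_eq_square)
    finally have e: "(\<Sum>i = 0..<k. i + p i + 1) = k ^ 2" .
    have "(\<Prod>i = 0..<k. ?A $$ (i, p i)) =
        (\<Prod>i = 0..<k. ?s ^ (i + p i + 1) * (?B $$ (i, p i)))"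
      by (rule prod.cong) (use lt in \<open>auto simp: bessel_I_2_csqrt simp del: power_Suc\<close>)
    also have "\<dots> = ?s ^ (\<Sum>i = 0..<k. i + p i + 1) * (\<Prod>i = 0..<k. ?B $$ (i, p i))"
      unfolding prod.distrib power_sum ..
    finally show ?thesis unfolding e .
  qed
  have "Determinant.det ?A = ?s ^ (k ^ 2) * Determinant.det ?B"
    unfolding det_def'[OF mat_carrier] sum_distrib_left
    by (rule sum.cong) (use prod in \<open>auto simp: mult_ac\<close>)
  moreover have "?s ^ (k ^ 2) = x powr (of_nat k ^ 2 / 2)"
  proof -
    have "?s = exp (Ln x / 2)" using assms by (simp add: csqrt_exp_Ln)
    then have "?s ^ (k ^ 2) = exp (of_nat (k ^ 2) * (Ln x / 2))"
      by (simp only: exp_of_nat_mult)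
    then show ?thesis using assms by (simp add: powr_def mult_ac)
  qed
  ultimately show ?thesis
    using assms by (simp add: bessel_expr_def bessel_det_def powr_minus)
qed

lemma remove_sings_bessel_expr:
  "remove_sings (bessel_expr k) = (\<lambda>x.
    exp (- x / 2) * Determinant.det (Matrix.mat k k (\<lambda>(i, j). bessel_series (i + j + 1) x)))"
    (is "_ = ?F")
  and remove_sings_bessel_expr_holomorphic:
    "remove_sings (bessel_expr k) holomorphic_on UNIV"
proof -
  have d: "Determinant.det (Matrix.mat k k (\<lambda>(i, j). bessel_series (i + j + 1) x)) =
     (\<Sum>p | p permutes {0..<k}. signof p * (\<Prod>i = 0..<k. bessel_series (i + p i + 1) x))" for x
    unfolding det_def'[OF mat_carrier]
    by (intro sum.cong prod.cong arg_cong2[where f = "(*)"] refl)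
       (auto simp: permutes_in_image)
  have hol: "?F holomorphic_on UNIV"
    unfolding d by (intro holomorphic_intros bessel_series_holomorphic) auto
  have "remove_sings (bessel_expr k) x = ?F x" for x
  proof (rule remove_sings_eqI)
    have "isCont ?F x"
      using holomorphic_on_imp_continuous_on[OF hol] by (simp add: continuous_on_eq_continuous_at)
    then have "?F \<midarrow>x\<rightarrow> ?F x" by (simp add: isCont_def)
    moreover have "eventually (\<lambda>y. bessel_expr k y = ?F y) (at x)"
      using eventually_neq_at_within[of 0 x UNIV]
      by eventually_elim (rule bessel_expr_eq_series)
    ultimately show "bessel_expr k \<midarrow>x\<rightarrow> ?F x"
      using tendsto_cong by fastforce
  qed
  then show eq: "remove_sings (bessel_expr k) = ?F" by auto
  show "remove_sings (bessel_expr k) holomorphic_on UNIV" unfolding eq by (rule hol)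
qed

end

theory Submission
  imports Defs
begin

text \<open>
  Expand the determinant over permutations and read off the coefficient of \<open>x\<^sup>2\<^sup>k\<close> in each product
  of power series. Collecting the permutations again, every tuple \<open>m\<close> contributes a determinant
  whose rows come from the tuple: after reversing the order of rows and columns it is
  \<open>det (1 / (a\<^sub>i - j)!)\<close> with \<open>a\<^sub>i = 2 k - 1 - i + m\<^sub>i\<^sub>+\<^sub>1\<close> and \<open>0 \<le> i, j < k\<close>. Pulling \<open>1 / a\<^sub>i!\<close> out of row
  \<open>i\<close> leaves falling factorials of \<open>a\<^sub>i\<close>, that is, monic polynomials of degree \<open>j\<close> evaluated at \<open>a\<^sub>i\<close>,
  so the remaining determinant is the Vandermonde product of the \<open>a\<^sub>i\<close>.
\<close>

subsection \<open>Determinants\<close>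

text \<open>In the Leibniz formula every permutation takes exactly one entry from each row, so each
  summand acquires all the factors \<open>c i\<close>.\<close>

lemma det_scale_rows:
  fixes A :: "'a :: comm_ring_1 mat"
  assumes "A \<in> carrier_mat n n"
  shows "Determinant.det (Matrix.mat n n (\<lambda>(i, j). c i * A $$ (i, j))) =
    (\<Prod>i<n. c i) * Determinant.det A"
proof -
  have "(\<Prod>i = 0..<n. Matrix.mat n n (\<lambda>(i, j). c i * A $$ (i, j)) $$ (i, p i)) =
      (\<Prod>i<n. c i) * (\<Prod>i = 0..<n. A $$ (i, p i))"
    if "p permutes {0..<n}" for p
  proof -
    have "(\<Prod>i = 0..<n. Matrix.mat n n (\<lambda>(i, j). c i * A $$ (i, j)) $$ (i, p i)) =
        (\<Prod>i = 0..<n. c i * A $$ (i, p i))"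
      using permutes_in_image[OF that] by (intro prod.cong) auto
    then show ?thesis by (simp add: prod.distrib atLeast0LessThan)
  qed
  then show ?thesis
    unfolding det_def'[OF mat_carrier] det_def'[OF assms] sum_distrib_left
    by (intro sum.cong) (auto simp: mult_ac)
qed

text \<open>The reversal acts once on rows and once on columns, so its sign enters twice and squares
  to 1. Columns are treated as rows of the transpose.\<close>

lemma det_reverse_rows_cols:
  fixes A :: "'a :: comm_ring_1 mat"
  assumes A: "A \<in> carrier_mat n n"
  shows "Determinant.det (Matrix.mat n n (\<lambda>(i, j). A $$ (n - 1 - i, n - 1 - j))) =
    Determinant.det A"
proof -
  \<comment> \<open>Outside \<open>{0..<n}\<close> the reversal is the identity, as
    \<open>permutes\<close> demands.\<close>
  define r where "r = (\<lambda>i. if i < n then n - 1 - i else i)"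
  have r: "r permutes {0..<n}"
    by (rule bij_imp_permutes, rule bij_betwI[of _ _ _ r]) (auto simp: r_def)
  let ?B = "Matrix.mat n n (\<lambda>(i, j). A $$ (r i, j))"
  let ?C = "Matrix.mat n n (\<lambda>(i, j). A $$ (n - 1 - i, n - 1 - j))"
  have B: "transpose_mat ?B \<in> carrier_mat n n" by simp
  have "transpose_mat ?C = Matrix.mat n n (\<lambda>(i, j). transpose_mat ?B $$ (r i, j))"
    by (rule eq_matI) (auto simp: r_def)
  then have "Determinant.det ?C = signof r * Determinant.det (transpose_mat ?B)"
    using det_permute_rows[OF B r] det_transpose[of ?C n] by simp
  also have "\<dots> = signof r * (signof r * Determinant.det A)"
    using det_permute_rows[OF A r] det_transpose[of ?B n] by simp
  also have "\<dots> = Determinant.det A"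
    by (simp add: sign_def)
  finally show ?thesis .
qed

text \<open>Passing from the nodes \<open>c\<close> to the nodes \<open>a\<close> is a unitriangular change of basis, and for the
  nodes \<open>a\<close> the matrix is itself triangular.\<close>

lemma det_newton_basis:
  fixes a c :: "nat \<Rightarrow> 'a :: idom"
  shows "Determinant.det (Matrix.mat n n (\<lambda>(i, j). \<Prod>l<j. a i - c l)) =
    (\<Prod>j<n. \<Prod>i<j. a j - a i)"
proof -
  \<comment> \<open>The values \<open>u l\<close> are coordinates in the Newton basis for the nodes
    \<open>a\<close>. Fixing them to 0 beyond \<open>j\<close> makes the matrix \<open>?U\<close>
    below triangular.\<close>
  have "\<exists>u. u j = 1 \<and> (\<forall>l>j. u l = 0) \<and>
      (\<forall>x. (\<Prod>i<j. x - c i) = (\<Sum>l\<le>j. u l * (\<Prod>i<l. x - a i)))" for j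
  proof (induction j)
    case 0
    show ?case by (intro exI[of _ "\<lambda>l. if l = 0 then 1 else 0"]) auto
  next
    case (Suc j)
    then obtain u where u: "u j = 1" "\<And>l. l > j \<Longrightarrow> u l = 0"
      and eq: "\<And>x. (\<Prod>i<j. x - c i) = (\<Sum>l\<le>j. u l * (\<Prod>i<l. x - a i))" by blast
    define N where "N = (\<lambda>x l. \<Prod>i<l. x - a i)"
    \<comment> \<open>Multiply by \<open>x - c j = (x - a l) + (a l - c j)\<close>: the first
      summand moves the basis product of index \<open>l\<close> to index \<open>l + 1\<close>, the
      second only scales it.\<close>
    define v where "v = (\<lambda>l. (if l = 0 then 0 else u (l - 1)) + (a l - c j) * u l)"
    have "(\<Prod>i<Suc j. x - c i) = (\<Sum>l\<le>Suc j. v l * N x l)" for x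
    proof -
      have "(\<Sum>l\<le>Suc j. v l * N x l) =
          (\<Sum>l\<le>Suc j. (if l = 0 then 0 else u (l - 1)) * N x l) + (\<Sum>l\<le>Suc j. (a l - c j) * u l * N x l)"
        by (simp only: v_def distrib_right sum.distrib)
      also have "(\<Sum>l\<le>Suc j. (if l = 0 then 0 else u (l - 1)) * N x l) = (\<Sum>l\<le>j. u l * N x (Suc l))"
        by (simp add: sum.atMost_Suc_shift del: sum.atMost_Suc)
      also have "(\<Sum>l\<le>Suc j. (a l - c j) * u l * N x l) = (\<Sum>l\<le>j. (a l - c j) * u l * N x l)"
        by (simp add: u)
      also have "(\<Sum>l\<le>j. u l * N x (Suc l)) + (\<Sum>l\<le>j. (a l - c j) * u l * N x l) =
          (\<Sum>l\<le>j. u l * N x l) * (x - c j)"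
        unfolding sum.distrib[symmetric] sum_distrib_right
        by (intro sum.cong) (auto simp: N_def algebra_simps)
      finally show ?thesis by (simp add: eq N_def)
    qed
    then show ?case by (intro exI[of _ v]) (auto simp: v_def u N_def)
  qed
  then have "\<exists>u. \<forall>j. u j j = 1 \<and> (\<forall>l>j. u j l = 0) \<and>
      (\<forall>x. (\<Prod>i<j. x - c i) = (\<Sum>l\<le>j. u j l * (\<Prod>i<l. x - a i)))"
    by (intro choice allI)
  then obtain u where u: "\<And>j. u j j = 1" "\<And>j l. j < l \<Longrightarrow> u j l = 0"
    and eq: "\<And>j x. (\<Prod>i<j. x - c i) = (\<Sum>l\<le>j. u j l * (\<Prod>i<l. x - a i))"
    by blast
  let ?N = "Matrix.mat n n (\<lambda>(i, l). \<Prod>s<l. a i - a s)"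
  let ?U = "Matrix.mat n n (\<lambda>(l, j). u j l)"
  have "Matrix.mat n n (\<lambda>(i, j). \<Prod>l<j. a i - c l) = ?N * ?U"
  proof (rule eq_matI)
    fix i j assume "i < dim_row (?N * ?U)" "j < dim_col (?N * ?U)"
    then have ij: "i < n" "j < n" by auto
    have "(\<Prod>l<j. a i - c l) = (\<Sum>l\<in>{..j}. (\<Prod>s<l. a i - a s) * u j l)"
      by (simp add: eq mult.commute)
    also have "\<dots> = (\<Sum>l\<in>{0..<n}. (\<Prod>s<l. a i - a s) * u j l)"
      using ij u(2) by (intro sum.mono_neutral_left) auto
    finally show "Matrix.mat n n (\<lambda>(i, j). \<Prod>l<j. a i - c l) $$ (i, j) = (?N * ?U) $$ (i, j)"
      using ij by (simp add: scalar_prod_def)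
  qed auto
  then have "Determinant.det (Matrix.mat n n (\<lambda>(i, j). \<Prod>l<j. a i - c l)) =
      Determinant.det ?N * Determinant.det ?U"
    by (simp add: det_mult[of _ n])
  also have "Determinant.det ?U = 1"
    by (subst det_upper_triangular[of _ n]) (auto simp: u prod_list_diag_prod)
  \<comment> \<open>Above the diagonal the product contains the factor with \<open>s = i\<close>,
    which is 0.\<close>
  also have "Determinant.det ?N = (\<Prod>j<n. \<Prod>i<j. a j - a i)"
    by (subst det_lower_triangular[of n])
      (auto simp: prod_list_diag_prod atLeast0LessThan)
  finally show ?thesis by simp
qed

text \<open>Each step cancels one factor of a factorial. The product on the right is a monic
  polynomial in \<open>a\<close> with roots 0, ..., \<open>j - 1\<close>, the form to which
  \<open>det_newton_basis\<close> applies.\<close>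

lemma inverse_fact_diff:
  assumes "j \<le> a"
  shows "1 / fact (a - j) = (1 / fact a * (\<Prod>l<j. of_nat a - of_nat l) :: 'a :: field_char_0)"
  using assms
proof (induction j)
  case (Suc j)
  then have "a - j = Suc (a - Suc j)" by simp
  then have "(fact (a - j) :: 'a) = (of_nat a - of_nat j) * fact (a - Suc j)"
    using Suc.prems by (metis Suc_leD fact_Suc of_nat_diff)
  moreover have "(of_nat a - of_nat j :: 'a) \<noteq> 0"
    using Suc.prems by (simp flip: of_nat_diff)
  ultimately have "1 / (fact (a - Suc j) :: 'a) = 1 / fact (a - j) * (of_nat a - of_nat j)"
    by simp
  then show ?case using Suc by simp
qed simp

subsection \<open>Power series\<close>

text \<open>The series converges everywhere by comparison with the exponential series at
  \<open>norm x\<close>.\<close>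

lemma bessel_series_has_fps_expansion:
  "bessel_series n has_fps_expansion Abs_fps (\<lambda>l. 1 / (fact (n + l) * fact l))"
proof (rule has_fps_expansionI)
  have "(\<lambda>l. x ^ l / (fact (n + l) * fact l)) sums bessel_series n x" for x
  proof -
    have "summable (\<lambda>l. x ^ l / (fact (n + l) * fact l))"
    proof (rule summable_comparison_test')
      show "summable (\<lambda>l. norm x ^ l / fact l)"
        using summable_exp[of "norm x"] by (simp add: field_simps)
      fix l :: nat
      have "norm x ^ l / (fact (n + l) * fact l) \<le> norm x ^ l / (1 * fact l)"
        by (intro divide_left_mono mult_right_mono) (auto simp: fact_ge_1)
      then show "norm (x ^ l / (fact (n + l) * fact l)) \<le> norm x ^ l / fact l"
        by (simp add: norm_mult norm_divide norm_power)
    qed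
    then show ?thesis by (simp add: bessel_series_def summable_sums)
  qed
  then show "\<forall>\<^sub>F x in nhds 0. (\<lambda>l. fps_nth (Abs_fps (\<lambda>l. 1 / (fact (n + l) * fact l))) l * x ^ l)
      sums bessel_series n x"
    by simp
qed

text \<open>Cauchy product of \<open>k + 1\<close> series: \<open>m ! 0\<close> is the degree taken
  from the exponential, \<open>m ! Suc i\<close> the one taken from factor \<open>i\<close>. Each
  series contributes one reciprocal factorial of its degree; together these form the denominator of
  the multinomial coefficient.\<close>

lemma fps_exp_mult_bessel_series_nth:
  fixes q :: "nat \<Rightarrow> nat" and c :: complex
  shows "fps_nth (fps_exp c * (\<Prod>i<k. Abs_fps (\<lambda>l. 1 / (fact (q i + l) * fact l)))) n =
    (\<Sum>m\<in>P_O (k + 1) n. c ^ (m ! 0) / (\<Prod>i<length m. fact (m ! i)) *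
      (\<Prod>i<k. 1 / fact (q i + m ! Suc i)))"
proof -
  define f where "f = (\<lambda>i. case i of 0 \<Rightarrow> fps_exp c
    | Suc i \<Rightarrow> Abs_fps (\<lambda>l. 1 / (fact (q i + l) * fact l)))"
  have split: "(\<Prod>i = 0..k. g i) = g 0 * (\<Prod>i<k. g (Suc i))" for g :: "nat \<Rightarrow> 'b :: comm_monoid_mult"
    by (simp add: atLeast0AtMost prod.lessThan_Suc_shift flip: lessThan_Suc_atMost
        del: prod.lessThan_Suc)
  have "fps_nth (fps_exp c * (\<Prod>i<k. Abs_fps (\<lambda>l. 1 / (fact (q i + l) * fact l)))) n =
      fps_nth (\<Prod>i = 0..k. f i) n"
    unfolding split by (simp add: f_def)
  also have "\<dots> = (\<Sum>m\<in>P_O (k + 1) n. \<Prod>i = 0..k. fps_nth (f i) (m ! i))"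
    by (simp add: fps_prod_nth P_O_def natpermute_def conj_commute)
  also have "\<dots> = (\<Sum>m\<in>P_O (k + 1) n. c ^ (m ! 0) / (\<Prod>i<length m. fact (m ! i)) *
      (\<Prod>i<k. 1 / fact (q i + m ! Suc i)))"
  proof (intro sum.cong refl)
    fix m assume "m \<in> P_O (k + 1) n"
    then have "{..<length m} = {0..k}" by (auto simp: P_O_def)
    then show "(\<Prod>i = 0..k. fps_nth (f i) (m ! i)) =
        c ^ (m ! 0) / (\<Prod>i<length m. fact (m ! i)) * (\<Prod>i<k. 1 / fact (q i + m ! Suc i))"
      by (simp only: split) (simp add: f_def prod_dividef prod.distrib)
  qed
  finally show ?thesis .
qed

text \<open>Links the 1-based pairs of the final formula with the 0-based Vandermonde
  product.\<close>

lemma prod_pairs_shift: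
  fixes f :: "nat \<Rightarrow> nat \<Rightarrow> 'a :: comm_monoid_mult"
  shows "(\<Prod>(i, j)\<in>{(i, j). 1 \<le> i \<and> i < j \<and> j \<le> k}. f i j) = (\<Prod>j<k. \<Prod>i<j. f (Suc i) (Suc j))"
proof -
  have "(\<Prod>j<k. \<Prod>i<j. f (Suc i) (Suc j)) = (\<Prod>(j, i)\<in>(SIGMA j:{..<k}. {..<j}). f (Suc i) (Suc j))"
    by (rule prod.Sigma) auto
  also have "\<dots> = (\<Prod>(i, j)\<in>{(i, j). 1 \<le> i \<and> i < j \<and> j \<le> k}. f i j)"
    by (rule prod.reindex_bij_witness[of _ "\<lambda>(i, j). (j - 1, i - 1)" "\<lambda>(j, i). (Suc i, Suc j)"]) auto
  finally show ?thesis ..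
qed

theorem theorem3:
  fixes k :: nat
  assumes "k > 0"
  shows "b' k = (-1) ^ (k * (k + 1) div 2) *
    (\<Sum>m \<in> P_O (k + 1) (2 * k).
       multinomial (2 * k) m * (- 1 / 2) ^ (m ! 0) *
       (\<Prod>i = 1..k. 1 / fact (2 * k - i + m ! i)) *
       (\<Prod>(i, j) \<in> {(i, j). 1 \<le> i \<and> i < j \<and> j \<le> k}.
          of_nat (m ! j) - of_nat (m ! i) + of_nat i - of_nat j))"
proof -
  \<comment> \<open>The Bessel order \<open>(k - 1 - i) + (k - 1 - p i) + 1\<close> in the reversed
    matrix; for \<open>i < k\<close> and \<open>p i < k\<close> no subtraction truncates.\<close>
  define q where "q = (\<lambda>p i. 2 * k - 1 - i - p i :: nat)"
  define G where "G = (\<lambda>p. fps_exp (- 1 / 2 :: complex) *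
    (\<Prod>i<k. Abs_fps (\<lambda>l. 1 / (fact (q p i + l) * fact l))))"
  \<comment> \<open>The part of a summand that does not depend on the permutation;
    \<open>fact (2 * k) * w m\<close> is the multinomial coefficient times the power of
    -1/2.\<close>
  define w where "w = (\<lambda>m. (- 1 / 2 :: complex) ^ (m ! 0) / (\<Prod>i<length m. fact (m ! i)))"
  have F: "remove_sings (bessel_expr k) = (\<lambda>x. \<Sum>p | p permutes {0..<k}.
      signof p * (exp (- 1 / 2 * x) * (\<Prod>i<k. bessel_series (q p i) x)))"
  proof
    fix x
    let ?A = "Matrix.mat k k (\<lambda>(i, j). bessel_series (i + j + 1) x)"
    let ?B = "Matrix.mat k k (\<lambda>(i, j). ?A $$ (k - 1 - i, k - 1 - j))"
    have "Determinant.det ?A = Determinant.det ?B"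
      by (rule det_reverse_rows_cols[symmetric]) simp
    also have "\<dots> = (\<Sum>p | p permutes {0..<k}. signof p * (\<Prod>i<k. bessel_series (q p i) x))"
      unfolding det_def'[OF mat_carrier] atLeast0LessThan
    proof (intro sum.cong prod.cong arg_cong2[where f = "(*)"] refl)
      fix p i assume "p \<in> {p. p permutes {..<k}}" "i \<in> {..<k}"
      then have "i < k" "p i < k" using permutes_in_image[of p "{..<k}" i] by auto
      moreover from this have "(k - 1 - i) + (k - 1 - p i) + 1 = q p i"
        by (simp add: q_def Suc_diff_Suc mult_2)
      moreover from calculation(1,2)
      have "?B $$ (i, p i) = bessel_series ((k - 1 - i) + (k - 1 - p i) + 1) x"
        by (simp add: add.commute)
      ultimately show "?B $$ (i, p i) = bessel_series (q p i) x" by (simp only:)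
    qed
    finally show "remove_sings (bessel_expr k) x = (\<Sum>p | p permutes {0..<k}.
        signof p * (exp (- 1 / 2 * x) * (\<Prod>i<k. bessel_series (q p i) x)))"
      by (simp add: remove_sings_bessel_expr sum_distrib_left mult_ac)
  qed
  have "remove_sings (bessel_expr k) has_fps_expansion
      (\<Sum>p | p permutes {0..<k}. fps_const (signof p) * G p)"
    unfolding F G_def
    by (intro has_fps_expansion_sum has_fps_expansion_cmult_left has_fps_expansion_mult
        has_fps_expansion_exp has_fps_expansion_prod bessel_series_has_fps_expansion)
  from fps_nth_fps_expansion[OF this, of "2 * k"]
  have "(deriv ^^ (2 * k)) (remove_sings (bessel_expr k)) 0 =
      fact (2 * k) * (\<Sum>p | p permutes {0..<k}. signof p * fps_nth (G p) (2 * k))"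
    by (simp add: fps_sum_nth)
  also have "\<dots> = fact (2 * k) * (\<Sum>p | p permutes {0..<k}. \<Sum>m\<in>P_O (k + 1) (2 * k).
      signof p * (w m * (\<Prod>i<k. 1 / fact (q p i + m ! Suc i))))"
    by (simp only: G_def fps_exp_mult_bessel_series_nth w_def sum_distrib_left)
  \<comment> \<open>With \<open>m\<close> fixed, the inner sum over \<open>p\<close> is again a
    Leibniz expansion.\<close>
  also have "\<dots> = (\<Sum>m\<in>P_O (k + 1) (2 * k). fact (2 * k) * w m *
      (\<Sum>p | p permutes {0..<k}. signof p * (\<Prod>i<k. 1 / fact (q p i + m ! Suc i))))"
    by (subst sum.swap) (simp add: sum_distrib_left mult_ac)
  also have "\<dots> = (\<Sum>m\<in>P_O (k + 1) (2 * k). fact (2 * k) * w m *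
      ((\<Prod>i = 1..k. 1 / fact (2 * k - i + m ! i)) *
       (\<Prod>(i, j) \<in> {(i, j). 1 \<le> i \<and> i < j \<and> j \<le> k}.
          of_nat (m ! j) - of_nat (m ! i) + of_nat i - of_nat j)))"
  proof (intro sum.cong arg_cong2[where f = "(*)"] refl)
    fix m :: "nat list"
    \<comment> \<open>Chosen so that \<open>q p i + m ! Suc i = a i - p i\<close>; the index
      \<open>Suc i\<close> skips the exponential's entry \<open>m ! 0\<close>.\<close>
    define a where "a = (\<lambda>i. 2 * k - Suc i + m ! Suc i)"
    let ?V = "Matrix.mat k k (\<lambda>(i, j). \<Prod>l<j. of_nat (a i) - of_nat l) :: complex mat"
    have "(\<Sum>p | p permutes {0..<k}. signof p * (\<Prod>i<k. 1 / fact (q p i + m ! Suc i) :: complex)) =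
        Determinant.det (Matrix.mat k k (\<lambda>(i, j). 1 / fact (a i - j)))"
      unfolding det_def'[OF mat_carrier] atLeast0LessThan
    proof (intro sum.cong prod.cong arg_cong2[where f = "(*)"] refl)
      fix p i assume "p \<in> {p. p permutes {..<k}}" "i \<in> {..<k}"
      then have "i < k" "p i < k" using permutes_in_image[of p "{..<k}" i] by auto
      moreover from this have "q p i + m ! Suc i = a i - p i" by (simp add: q_def a_def)
      ultimately show "1 / fact (q p i + m ! Suc i) =
          Matrix.mat k k (\<lambda>(i, j). 1 / fact (a i - j) :: complex) $$ (i, p i)"
        by simp
    qed
    also have "Matrix.mat k k (\<lambda>(i, j). 1 / fact (a i - j) :: complex) =
        Matrix.mat k k (\<lambda>(i, j). 1 / fact (a i) * ?V $$ (i, j))"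
    proof (rule eq_matI)
      fix i j
      assume "i < dim_row (Matrix.mat k k (\<lambda>(i, j). 1 / fact (a i) * ?V $$ (i, j)))"
        and "j < dim_col (Matrix.mat k k (\<lambda>(i, j). 1 / fact (a i) * ?V $$ (i, j)))"
      then have ij: "i < k" "j < k" by simp_all
      \<comment> \<open>Since \<open>i < k\<close>, already \<open>2 * k - Suc i\<close> is at least
        \<open>k\<close>, which exceeds \<open>j\<close>.\<close>
      then have "j \<le> a i" by (simp add: a_def)
      from inverse_fact_diff[OF this] ij
      show "Matrix.mat k k (\<lambda>(i, j). 1 / fact (a i - j) :: complex) $$ (i, j) =
          Matrix.mat k k (\<lambda>(i, j). 1 / fact (a i) * ?V $$ (i, j)) $$ (i, j)" by simp
    qed simp_all
    also have "Determinant.det \<dots> =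
        (\<Prod>i<k. 1 / fact (a i)) * (\<Prod>j<k. \<Prod>i<j. of_nat (a j) - of_nat (a i))"
      by (simp only: det_scale_rows[OF mat_carrier] det_newton_basis)
    also have "(\<Prod>i<k. 1 / fact (a i) :: complex) = (\<Prod>i = 1..k. 1 / fact (2 * k - i + m ! i))"
      by (rule prod.reindex_bij_witness[of _ "\<lambda>i. i - 1" Suc]) (auto simp: a_def)
    \<comment> \<open>In \<open>a j - a i\<close> the terms \<open>2 * k\<close> cancel, and
      shifting both indices by one leaves \<open>i - j\<close> unchanged.\<close>
    also have "(\<Prod>j<k. \<Prod>i<j. of_nat (a j) - of_nat (a i) :: complex) =
        (\<Prod>(i, j) \<in> {(i, j). 1 \<le> i \<and> i < j \<and> j \<le> k}.
          of_nat (m ! j) - of_nat (m ! i) + of_nat i - of_nat j)"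
      unfolding prod_pairs_shift
      by (intro prod.cong) (auto simp: a_def of_nat_diff)
    finally show "(\<Sum>p | p permutes {0..<k}. signof p * (\<Prod>i<k. 1 / fact (q p i + m ! Suc i))) =
        (\<Prod>i = 1..k. 1 / fact (2 * k - i + m ! i)) *
        (\<Prod>(i, j) \<in> {(i, j). 1 \<le> i \<and> i < j \<and> j \<le> k}.
          of_nat (m ! j) - of_nat (m ! i) + of_nat i - of_nat j :: complex)" .
  qed
  finally show ?thesis
    by (simp add: b'_def w_def multinomial_def mult_ac)
qed

end
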